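(* Let $\varepsilon\ge0$. Suppose that there exist $\hat z_0\in\mathcal Z$ and $C<\infty$ with $\mathbb E_{Z\sim\hat{\mathbb P}}[c(Z,\hat z_0)]\le C$. Suppose further that there exist a norm $\|\cdot\|$ on $\mathbb R^d$ and $p\in\mathbb N$ such that (a) $c(z,\hat z)\ge\|z-\hat z\|^p$ for all $z,\hat z\in\mathcal Z$; and (b) $\mathrm{dom}(\ell)$ is convex, $\ell$ is $p$ times continuously differentiable on $\mathrm{rint}(\mathrm{dom}(\ell))$, and there exists $G>0$ with $\ell(z)\le G(1+\|z\|^p)$, $\|D^k\ell(z)\|\le G(1+\|z\|^{p-k})$ for all $k\in[p-1]$, and $\|D^p\ell(z)\|\le G$ for all $z\in\mathrm{rint}(\mathrm{dom}(\ell))$. Then $$\sup_{\mathbb Q\in\mathbb B_\varepsilon(\hat{\mathbb P})}\mathbb E_{Z\sim\mathbb Q}[\ell(Z)]\le\mathbb E_{\hat Z\sim\hat{\mathbb P}}[\ell(\hat Z)]+\sum_{k=1}^{p-1}\frac{\varepsilon^{1/p_k}}{k!}\,\mathbb E_{\hat Z\sim\hat{\mathbb P}}\big[\|D^k\ell(\hat Z)\|^{q_k}\big]^{1/q_k}+\frac{\varepsilon}{p!}\,\mathrm{lip}(D^{p-1}\ell)<\infty,$$ where $p_k=p/k$ and $q_k=p/(p-k)$ for all $k\in[p-1]$.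
   Context: $[n]=\{1,\dots,n\}$. $\mathcal Z\subseteq\mathbb R^d$ is non-empty and closed, $\mathcal P(\mathcal Z)$ is the set of probability distributions on $\mathcal Z$, and $\hat{\mathbb P}\in\mathcal P(\mathcal Z)$ is a reference distribution. The cost $c:\mathcal Z\times\mathcal Z\to[0,+\infty]$ satisfies $c(z,\hat z)=0$ iff $z=\hat z$. $d_c(\mathbb Q,\hat{\mathbb P})=\inf_\pi\mathbb E_{(Z,\hat Z)\sim\pi}[c(Z,\hat Z)]$ over all couplings $\pi$ of $\mathbb Q$ and $\hat{\mathbb P}$, and $\mathbb B_\varepsilon(\hat{\mathbb P})=\{\mathbb Q\in\mathcal P(\mathcal Z):d_c(\mathbb Q,\hat{\mathbb P})\le\varepsilon\}$. The loss function is $\ell:\mathbb R^d\to(-\infty,\infty]$ with $\mathrm{dom}(\ell)=\{z:\ell(z)<\infty\}$. Standing assumptions: $c$ is lower semicontinuous on $\mathcal Z\times\mathcal Z$; $\ell$ is upper semicontinuous and $\hat{\mathbb P}$-integrable on $\mathcal Z$; and $\mathcal Z\subseteq\mathrm{rint}(\mathrm{dom}(\ell))$, where $\mathrm{rint}$ is the relative interior. $D^k\ell(z)$ is the totally symmetric tensor of all $k$-th order partial derivatives of $\ell$ (with $D^0\ell=\ell$), $D^k\ell(z)[\xi_1,\dots,\xi_k]$ is the directional derivative along $\xi_1,\dots,\xi_k\in\mathbb R^d$, and the tensor norm induced by $\|\cdot\|$ is $\|D^k\ell(z)\|=\sup\{|D^k\ell(z)[\xi_1,\dots,\xi_k]|:\|\xi_i\|\le1\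 \forall i\in[k]\}$. $\mathrm{lip}(D^{k}\ell)$ is the Lipschitz modulus $\sup_{z\ne z'}\|D^{k}\ell(z)-D^{k}\ell(z')\|/\|z-z'\|$ over $z,z'\in\mathrm{rint}(\mathrm{dom}(\ell))$. *)

theory Defs
  imports "HOL-Probability.Probability"
begin

definition is_norm :: "('a::real_vector \<Rightarrow> real) \<Rightarrow> bool" where
  "is_norm N \<longleftrightarrow>
     (\<forall>x. 0 \<le> N x) \<and> (\<forall>x. N x = 0 \<longleftrightarrow> x = 0) \<and>
     (\<forall>a x. N (a *\<^sub>R x) = \<bar>a\<bar> * N x) \<and> (\<forall>x y. N (x + y) \<le> N x + N y)"

definition edom :: "('a \<Rightarrow> ereal) \<Rightarrow> 'a set" where
  "edom f = {z. f z < \<infinity>}"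

text \<open>At isolated points of \<open>S\<close> the filter is trivial and both conditions hold vacuously.\<close>

definition lsc_on :: "'a::topological_space set \<Rightarrow> ('a \<Rightarrow> 'b::complete_linorder) \<Rightarrow> bool" where
  "lsc_on S f \<longleftrightarrow> (\<forall>x\<in>S. f x \<le> Liminf (at x within S) f)"

definition usc_on :: "'a::topological_space set \<Rightarrow> ('a \<Rightarrow> 'b::complete_linorder) \<Rightarrow> bool" where
  "usc_on S f \<longleftrightarrow> (\<forall>x\<in>S. Limsup (at x within S) f \<le> f x)"

definition distributions_on :: "'a::topological_space set \<Rightarrow> 'a measure set" where
  "distributions_on Z = {Q. prob_space Q \<and> sets Q = sets (restrict_space borel Z)}"

definition couplings :: "'a measure \<Rightarrow> 'b measure \<Rightarrow> ('a \<times> 'b) measure set" where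
  "couplings Q P = {\<pi>. prob_space \<pi> \<and> sets \<pi> = sets (Q \<Otimes>\<^sub>M P) \<and>
                        distr \<pi> Q fst = Q \<and> distr \<pi> P snd = P}"

definition ot_cost :: "('a \<Rightarrow> 'b \<Rightarrow> ennreal) \<Rightarrow> 'a measure \<Rightarrow> 'b measure \<Rightarrow> ennreal" where
  "ot_cost c Q P = (INF \<pi>\<in>couplings Q P. \<integral>\<^sup>+(z, z'). c z z' \<partial>\<pi>)"

definition ot_ball ::
  "'a::topological_space set \<Rightarrow> ('a \<Rightarrow> 'a \<Rightarrow> ennreal) \<Rightarrow> real \<Rightarrow> 'a measure \<Rightarrow> 'a measure set" where
  "ot_ball Z c \<epsilon> P = {Q \<in> distributions_on Z. ot_cost c Q P \<le> ennreal \<epsilon>}"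

text \<open>Expectation as the integral of the positive part minus that of the negative part
  (\<^const>\<open>e2ennreal\<close> maps negative numbers to \<open>0\<close>). It is \<open>-\<infinity>\<close> if only the negative part has an
  infinite integral; since \<open>\<infinity> - \<infinity> = \<infinity>\<close> in \<^typ>\<open>ereal\<close>, it is \<open>\<infinity>\<close> if the positive part does.\<close>

definition ext_expectation :: "'a measure \<Rightarrow> ('a \<Rightarrow> ereal) \<Rightarrow> ereal" where
  "ext_expectation Q f =
     enn2ereal (\<integral>\<^sup>+z. e2ennreal (f z) \<partial>Q) - enn2ereal (\<integral>\<^sup>+z. e2ennreal (- f z) \<partial>Q)"

text \<open>Real powers of extended nonnegative numbers, for exponents \<open>a > 0\<close>.\<close>

definition enn_powr :: "ennreal \<Rightarrow> real \<Rightarrow> ennreal" where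
  "enn_powr x a = (if x = \<infinity> then \<infinity> else ennreal (enn2real x powr a))"

text \<open>A function on a relatively open set \<open>S\<close> can only be differentiated along the linear subspace
  parallel to the affine hull of \<open>S\<close>. If \<open>S\<close> has nonempty interior, this is the whole space.\<close>

definition directions :: "'a::real_vector set \<Rightarrow> 'a set" where
  "directions S = {x - y | x y. x \<in> affine hull S \<and> y \<in> affine hull S}"

definition dir_deriv :: "('a::real_vector \<Rightarrow> real) \<Rightarrow> 'a \<Rightarrow> 'a \<Rightarrow> real" where
  "dir_deriv f \<xi> z = deriv (\<lambda>t. f (z + t *\<^sub>R \<xi>)) 0"

text \<open>\<open>D_tensor f [\<xi>\<^sub>1, \<dots>, \<xi>\<^sub>k] z\<close> is the value \<open>D\<^sup>kf(z)[\<xi>\<^sub>1, \<dots>, \<xi>\<^sub>k]\<close> of the \<open>k\<close>-th derivative tensor.\<close>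

primrec D_tensor :: "('a::real_vector \<Rightarrow> real) \<Rightarrow> 'a list \<Rightarrow> 'a \<Rightarrow> real" where
  "D_tensor f [] = f"
| "D_tensor f (\<xi> # \<xi>s) = dir_deriv (D_tensor f \<xi>s) \<xi>"

primrec Ck_on :: "nat \<Rightarrow> 'a::real_normed_vector set \<Rightarrow> ('a \<Rightarrow> real) \<Rightarrow> bool" where
  "Ck_on 0 S f \<longleftrightarrow> continuous_on S f"
| "Ck_on (Suc k) S f \<longleftrightarrow>
     f differentiable_on S \<and> (\<forall>\<xi>\<in>directions S. Ck_on k S (dir_deriv f \<xi>))"

text \<open>The norm induced by \<open>N\<close> on \<open>k\<close>-tensors, which are represented as functions on lists of
  length \<open>k\<close> of vectors from \<open>V\<close>. For \<open>k = 0\<close> it is the absolute value.\<close>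

definition tensor_norm ::
  "('a \<Rightarrow> real) \<Rightarrow> 'a set \<Rightarrow> nat \<Rightarrow> ('a list \<Rightarrow> real) \<Rightarrow> ennreal" where
  "tensor_norm N V k T =
     (SUP \<xi>s\<in>{\<xi>s. length \<xi>s = k \<and> (\<forall>\<xi>\<in>set \<xi>s. \<xi> \<in> V \<and> N \<xi> \<le> 1)}. ennreal \<bar>T \<xi>s\<bar>)"

abbreviation rdom :: "('a::real_normed_vector \<Rightarrow> ereal) \<Rightarrow> 'a set" where
  "rdom f \<equiv> rel_interior (edom f)"

definition deriv_norm ::
  "('a::real_normed_vector \<Rightarrow> real) \<Rightarrow> ('a \<Rightarrow> ereal) \<Rightarrow> nat \<Rightarrow> 'a \<Rightarrow> ennreal" where
  "deriv_norm N f k z =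
     tensor_norm N (directions (rdom f)) k (\<lambda>\<xi>s. D_tensor (\<lambda>x. real_of_ereal (f x)) \<xi>s z)"

definition deriv_lip ::
  "('a::real_normed_vector \<Rightarrow> real) \<Rightarrow> ('a \<Rightarrow> ereal) \<Rightarrow> nat \<Rightarrow> ennreal" where
  "deriv_lip N f k =
     (SUP (z, z')\<in>{(z, z'). z \<in> rdom f \<and> z' \<in> rdom f \<and> z \<noteq> z'}.
        tensor_norm N (directions (rdom f)) k
          (\<lambda>\<xi>s. D_tensor (\<lambda>x. real_of_ereal (f x)) \<xi>s z - D_tensor (\<lambda>x. real_of_ereal (f x)) \<xi>s z')
        / ennreal (N (z - z')))"

end

theory Submission
  imports Defs
begin

text \<open>Restricting the loss to the segment from \<open>w\<close> to \<open>z\<close> and applying the one-dimensional Taylor formula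
  bounds \<open>loss z - loss w\<close> by \<open>\<Sum>\<^sub>k \<parallel>D\<^sup>k loss w\<parallel> N(z - w)\<^sup>k / k!\<close> plus the remainder
  \<open>lip(D\<^sup>p\<^sup>-\<^sup>1 loss) N(z - w)\<^sup>p / p!\<close>, since a derivative of order \<open>p\<close> in a unit direction is at most the
  Lipschitz modulus of the derivatives of order \<open>p - 1\<close>. Integrating this against a coupling of transport
  cost at most \<open>\<epsilon> + \<delta>\<close>, Hoelder's inequality with exponents \<open>p / (p - k)\<close> and \<open>p / k\<close> separates the
  tensor norms, which only involve the marginal \<open>P\<close>, from the cost. Finally \<open>\<delta>\<close> tends to \<open>0\<close>, so no optimal
  coupling is needed. Positive and negative parts of the loss are kept on opposite sides of all inequalities,
  so that every integral is one of a nonnegative function.\<close>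

section \<open>Arbitrary norms on a Euclidean space\<close>

lemma is_normD:
  assumes "is_norm N"
  shows "0 \<le> N x" "N x = 0 \<longleftrightarrow> x = 0" "N (a *\<^sub>R x) = \<bar>a\<bar> * N x" "N (x + y) \<le> N x + N y"
  using assms by (auto simp: is_norm_def)

text \<open>Homogeneity and the triangle inequality make \<open>N\<close> convex, and a finite
  convex function on a Euclidean space is continuous. Since \<open>N\<close> may differ from the
  norm of the type class, this is the source of its Borel measurability.\<close>

lemma is_norm_continuous:
  fixes N :: "'a::euclidean_space \<Rightarrow> real"
  assumes "is_norm N"
  shows "continuous_on UNIV N"
proof (rule convex_on_continuous)
  show "convex_on UNIV N"
  proof (rule convex_onI)
    fix t :: real and x y :: 'a
    assume t: "0 < t" "t < 1"
    have "N ((1 - t) *\<^sub>R x + t *\<^sub>R y) \<le> N ((1 - t) *\<^sub>R x) + N (t *\<^sub>R y)"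
      by (rule is_normD[OF assms])
    then show "N ((1 - t) *\<^sub>R x + t *\<^sub>R y) \<le> (1 - t) * N x + t * N y"
      using t by (simp add: is_normD(3)[OF assms])
  qed simp
qed simp

text \<open>Follows from bounding the sum of the two norms by twice their maximum. The crude
  constant suffices because the estimate only serves to show that moments are finite.\<close>

lemma is_norm_power_le:
  assumes "is_norm N"
  shows "N (x + y) ^ n \<le> 2 ^ n * (N x ^ n + N y ^ n)"
proof -
  have nn: "0 \<le> N x" "0 \<le> N y" "0 \<le> N (x + y)"
    by (simp_all add: is_normD[OF assms])
  have "N (x + y) \<le> 2 * max (N x) (N y)"
    using is_normD(4)[OF assms, of x y] by (simp add: max_def)
  then have "N (x + y) ^ n \<le> 2 ^ n * max (N x) (N y) ^ n"
    using nn by (metis power_mono power_mult_distrib)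
  also have "max (N x) (N y) ^ n \<le> N x ^ n + N y ^ n"
    using nn by (simp add: max_def)
  finally show ?thesis
    by simp
qed

section \<open>Derivatives along lines in a relatively open set\<close>

lemma line_in_affine_hull:
  assumes "z \<in> affine hull S" "\<xi> \<in> directions S"
  shows "z + t *\<^sub>R \<xi> \<in> affine hull S"
  using assms by (auto simp: directions_def intro: mem_affine_3_minus)

text \<open>A relatively open set is the trace of an open set on its affine hull. Moving along an
  admissible direction never leaves the hull, so only the open condition has to persist near
  \<open>t\<close>.\<close>

lemma eventually_line_in:
  fixes S :: "'a::euclidean_space set"
  assumes "rel_open S" "\<xi> \<in> directions S" "z + t *\<^sub>R \<xi> \<in> S"
  shows "\<forall>\<^sub>F s in nhds t. z + s *\<^sub>R \<xi> \<in> S"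
proof -
  obtain U where U: "open U" "S = affine hull S \<inter> U"
    using assms(1) by (auto simp: rel_open openin_open)
  have "(z + t *\<^sub>R \<xi>) + (s - t) *\<^sub>R \<xi> \<in> affine hull S" for s
    by (intro line_in_affine_hull hull_inc assms)
  then have aff: "z + s *\<^sub>R \<xi> \<in> affine hull S" for s
    by (simp add: algebra_simps)
  have "((\<lambda>s. z + s *\<^sub>R \<xi>) \<longlongrightarrow> z + t *\<^sub>R \<xi>) (nhds t)"
    by (intro tendsto_intros filterlim_ident)
  then have "\<forall>\<^sub>F s in nhds t. z + s *\<^sub>R \<xi> \<in> U"
    using U assms(3) by (auto dest: topological_tendstoD)
  then show ?thesis
    by eventually_elim (use U aff in blast)
qed

text \<open>Chain rule. Differentiability within \<open>S\<close> yields a genuine two-sided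
  derivative along the line, since the line stays in \<open>S\<close> for all parameters near
  \<open>t\<close>.\<close>

lemma dir_deriv_line:
  fixes S :: "'a::euclidean_space set"
  assumes "rel_open S" "f differentiable_on S" "\<xi> \<in> directions S" "z + t *\<^sub>R \<xi> \<in> S"
  shows "((\<lambda>s. f (z + s *\<^sub>R \<xi>)) has_real_derivative dir_deriv f \<xi> (z + t *\<^sub>R \<xi>)) (at t)"
proof -
  let ?g = "\<lambda>s. z + s *\<^sub>R \<xi>"
  obtain f' where f': "(f has_derivative f') (at (?g t) within S)"
    using assms(2,4) by (auto simp: differentiable_on_def differentiable_def)
  obtain U where U: "open U" "t \<in> U" "\<And>s. s \<in> U \<Longrightarrow> ?g s \<in> S"
    using eventually_line_in[OF assms(1,3,4)] by (auto simp: eventually_nhds)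
  have "(?g has_derivative (\<lambda>s. s *\<^sub>R \<xi>)) (at t within U)"
    by (auto intro!: derivative_eq_intros)
  moreover have "(f has_derivative f') (at (?g t) within ?g ` U)"
    using f' U(3) by (auto intro: has_derivative_subset)
  ultimately have "((\<lambda>s. f (?g s)) has_derivative (\<lambda>s. f' (s *\<^sub>R \<xi>))) (at t within U)"
    using has_derivative_compose has_derivative_in_compose by blast
  then have "((\<lambda>s. f (?g s)) has_derivative (\<lambda>s. f' (s *\<^sub>R \<xi>))) (at t)"
    using U at_within_open by metis
  moreover have "(\<lambda>s. f' (s *\<^sub>R \<xi>)) = (*) (f' \<xi>)"
    using has_derivative_linear[OF f'] by (auto simp: linear_cmul mult.commute)
  ultimately have D: "((\<lambda>s. f (?g s)) has_real_derivative f' \<xi>) (at t)"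
    by (simp add: has_field_derivative_def)
  \<comment> \<open>\<open>dir_deriv\<close> is a derivative at parameter \<open>0\<close>, so the
    base point of the line is moved to \<open>?g t\<close>.\<close>
  then have "((\<lambda>s. f (?g (s + t))) has_real_derivative f' \<xi>) (at 0)"
    using DERIV_shift[of "\<lambda>s. f (?g s)" "f' \<xi>" 0 t] by simp
  then have "((\<lambda>s. f (?g t + s *\<^sub>R \<xi>)) has_real_derivative f' \<xi>) (at 0)"
    by (simp add: algebra_simps)
  then have "dir_deriv f \<xi> (?g t) = f' \<xi>"
    unfolding dir_deriv_def by (rule DERIV_imp_deriv)
  with D show ?thesis
    by simp
qed

text \<open>Every direction in the list uses up one order of smoothness. The head of the list is
  differentiated last, so the induction hypothesis is applied with one order to spare.\<close>

lemma Ck_on_D_tensor: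
  assumes "Ck_on (n + length \<xi>s) S f" "set \<xi>s \<subseteq> directions S"
  shows "Ck_on n S (D_tensor f \<xi>s)"
  using assms
proof (induction \<xi>s arbitrary: n)
  case (Cons \<xi> \<xi>s)
  have "Ck_on (Suc n) S (D_tensor f \<xi>s)"
    using Cons.prems by (intro Cons.IH) auto
  with Cons.prems show ?case
    by simp
qed simp

text \<open>Turns iterated directional derivatives into successive derivatives of one real variable.
  The strict inequality on the length leaves the one order of smoothness that the last
  differentiation needs.\<close>

lemma D_tensor_line:
  fixes S :: "'a::euclidean_space set"
  assumes "rel_open S" "Ck_on p S f" "length \<xi>s < p" "set \<xi>s \<subseteq> directions S"
    and "\<xi> \<in> directions S" "z + t *\<^sub>R \<xi> \<in> S"
  shows "((\<lambda>s. D_tensor f \<xi>s (z + s *\<^sub>R \<xi>)) has_real_derivative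
           D_tensor f (\<xi> # \<xi>s) (z + t *\<^sub>R \<xi>)) (at t)"
proof -
  have "Suc (p - Suc (length \<xi>s)) + length \<xi>s = p"
    using assms(3) by simp
  then have "Ck_on (Suc (p - Suc (length \<xi>s))) S (D_tensor f \<xi>s)"
    using assms by (intro Ck_on_D_tensor) auto
  then show ?thesis
    using assms by (auto intro!: dir_deriv_line)
qed

lemma Ck_on_imp_continuous_on: "Ck_on k S f \<Longrightarrow> continuous_on S f"
  by (cases k) (auto intro: differentiable_imp_continuous_on)

lemma continuous_on_D_tensor:
  assumes "Ck_on p S f" "length \<xi>s \<le> p" "set \<xi>s \<subseteq> directions S"
  shows "continuous_on S (D_tensor f \<xi>s)"
proof -
  have "Ck_on (p - length \<xi>s) S (D_tensor f \<xi>s)"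
    using assms by (intro Ck_on_D_tensor) auto
  then show ?thesis
    by (rule Ck_on_imp_continuous_on)
qed

section \<open>Tensor norms and the multivariate Taylor bound\<close>

lemma tensor_norm_upper:
  assumes "length \<xi>s = k" "set \<xi>s \<subseteq> V" "\<And>\<xi>. \<xi> \<in> set \<xi>s \<Longrightarrow> N \<xi> \<le> 1"
  shows "ennreal \<bar>T \<xi>s\<bar> \<le> tensor_norm N V k T"
  unfolding tensor_norm_def using assms by (intro SUP_upper) auto

text \<open>Parametrizes the segment from \<open>w\<close> to \<open>z\<close> with unit speed in
  \<open>N\<close>, so that parameters are distances and the direction is admissible in the supremum
  defining \<open>tensor_norm\<close>.\<close>

lemma directions_segment:
  fixes S :: "'a::euclidean_space set"
  assumes "is_norm N" "convex S" "z \<in> S" "w \<in> S" "z \<noteq> w"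
  defines "\<xi> \<equiv> (z - w) /\<^sub>R N (z - w)"
  shows "\<xi> \<in> directions S" "N \<xi> = 1" "w + N (z - w) *\<^sub>R \<xi> = z" "0 < N (z - w)"
    and "\<And>t. 0 \<le> t \<Longrightarrow> t \<le> N (z - w) \<Longrightarrow> w + t *\<^sub>R \<xi> \<in> S"
proof -
  have pos: "0 < N (z - w)"
    using is_normD(1,2)[OF assms(1), of "z - w"] assms(5) by (auto simp: less_le)
  then show "0 < N (z - w)" "N \<xi> = 1" and eq: "w + N (z - w) *\<^sub>R \<xi> = z"
    by (simp_all add: \<xi>_def is_normD(3)[OF assms(1)])
  have "w + inverse (N (z - w)) *\<^sub>R (z - w) \<in> affine hull S" "w \<in> affine hull S"
    using assms(3,4) by (auto intro!: mem_affine_3_minus simp: hull_inc)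
  moreover have "\<xi> = (w + inverse (N (z - w)) *\<^sub>R (z - w)) - w"
    by (simp add: \<xi>_def)
  ultimately show "\<xi> \<in> directions S"
    unfolding directions_def by blast
  fix t assume t: "0 \<le> t" "t \<le> N (z - w)"
  define s where "s = t / N (z - w)"
  have "w + t *\<^sub>R \<xi> = (1 - s) *\<^sub>R w + s *\<^sub>R z"
    by (simp add: \<xi>_def s_def algebra_simps divide_inverse)
  moreover have "0 \<le> s" "s \<le> 1"
    using t pos by (auto simp: s_def)
  ultimately show "w + t *\<^sub>R \<xi> \<in> S"
    using assms by (simp add: convexD)
qed

text \<open>For each fixed list of directions, the mean value theorem along the segment expresses
  the difference by a derivative of order \<open>Suc k\<close>, whose additional direction is the
  unit vector of the segment.\<close>

lemma D_tensor_lipschitz: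
  fixes S :: "'a::euclidean_space set"
  assumes "is_norm N" "rel_open S" "convex S" "Ck_on (Suc k) S f"
    and bound: "\<And>z. z \<in> S \<Longrightarrow> tensor_norm N (directions S) (Suc k) (\<lambda>\<xi>s. D_tensor f \<xi>s z) \<le> ennreal G"
    and "0 \<le> G" "z \<in> S" "w \<in> S" "z \<noteq> w"
  shows "tensor_norm N (directions S) k (\<lambda>\<xi>s. D_tensor f \<xi>s z - D_tensor f \<xi>s w)
           \<le> ennreal (G * N (z - w))"
  unfolding tensor_norm_def
proof (rule SUP_least)
  fix \<xi>s assume "\<xi>s \<in> {\<xi>s. length \<xi>s = k \<and> (\<forall>\<xi>\<in>set \<xi>s. \<xi> \<in> directions S \<and> N \<xi> \<le> 1)}"
  then have len: "length \<xi>s = k" and \<xi>s: "set \<xi>s \<subseteq> directions S" "\<And>\<xi>. \<xi> \<in> set \<xi>s \<Longrightarrow> N \<xi> \<le> 1"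
    by auto
  define \<xi> where "\<xi> = (z - w) /\<^sub>R N (z - w)"
  note seg = directions_segment[OF assms(1,3,7,8,9), folded \<xi>_def]
  have "\<exists>t. t > 0 \<and> t < N (z - w) \<and>
      D_tensor f \<xi>s (w + N (z - w) *\<^sub>R \<xi>) - D_tensor f \<xi>s (w + 0 *\<^sub>R \<xi>)
        = (N (z - w) - 0) * D_tensor f (\<xi> # \<xi>s) (w + t *\<^sub>R \<xi>)"
    using seg len \<xi>s assms by (intro MVT2[OF seg(4)] D_tensor_line[of S "Suc k"]) auto
  then obtain t where t: "0 < t" "t < N (z - w)"
    "D_tensor f \<xi>s z - D_tensor f \<xi>s w = N (z - w) * D_tensor f (\<xi> # \<xi>s) (w + t *\<^sub>R \<xi>)"
    by (auto simp only: seg(3) scaleR_zero_left add_0_right diff_zero)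
  have S: "w + t *\<^sub>R \<xi> \<in> S"
    using t by (intro seg) auto
  have "ennreal \<bar>D_tensor f (\<xi> # \<xi>s) (w + t *\<^sub>R \<xi>)\<bar>
      \<le> tensor_norm N (directions S) (Suc k) (\<lambda>\<xi>s. D_tensor f \<xi>s (w + t *\<^sub>R \<xi>))"
    using seg len \<xi>s by (intro tensor_norm_upper) auto
  also have "\<dots> \<le> ennreal G"
    by (intro bound S)
  finally have "\<bar>D_tensor f (\<xi> # \<xi>s) (w + t *\<^sub>R \<xi>)\<bar> \<le> G"
    using assms(6) by simp
  then show "ennreal \<bar>D_tensor f \<xi>s z - D_tensor f \<xi>s w\<bar> \<le> ennreal (G * N (z - w))"
    using seg(4) t(3) by (auto intro!: ennreal_leI simp: abs_mult mult.commute)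
qed

text \<open>The difference quotients are bounded by \<open>L\<close> near \<open>t\<close>, and the
  bound passes to their limit.\<close>

lemma DERIV_abs_le_lipschitz:
  fixes g :: "real \<Rightarrow> real"
  assumes "(g has_real_derivative g') (at t)"
    and "\<forall>\<^sub>F s in at t. \<bar>g s - g t\<bar> \<le> L * \<bar>s - t\<bar>"
  shows "\<bar>g'\<bar> \<le> L"
proof (rule tendsto_upperbound)
  show "((\<lambda>s. \<bar>(g s - g t) / (s - t)\<bar>) \<longlongrightarrow> \<bar>g'\<bar>) (at t)"
    using assms(1) unfolding has_field_derivative_iff by (rule tendsto_rabs)
  show "\<forall>\<^sub>F s in at t. \<bar>(g s - g t) / (s - t)\<bar> \<le> L"
    using assms(2) eventually_neq_at_within[of t t UNIV]
    by eventually_elim (auto simp: abs_divide divide_simps)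
qed simp

text \<open>Maclaurin's formula with Lagrange remainder along the segment. The terms of order at
  most \<open>m\<close> are bounded by tensor norms at \<open>w\<close>, the remainder by a
  Lipschitz constant of the derivatives of order \<open>m\<close>.\<close>

lemma taylor_upper_bound:
  fixes S :: "'a::euclidean_space set"
  assumes "is_norm N" "rel_open S" "convex S" "Ck_on (Suc m) S f"
    and L: "\<And>z w. z \<in> S \<Longrightarrow> w \<in> S \<Longrightarrow> z \<noteq> w \<Longrightarrow>
      tensor_norm N (directions S) m (\<lambda>\<xi>s. D_tensor f \<xi>s z - D_tensor f \<xi>s w)
        \<le> ennreal (L * N (z - w))" "0 \<le> L"
    and D: "\<And>k. k \<in> {1..m} \<Longrightarrow>
      tensor_norm N (directions S) k (\<lambda>\<xi>s. D_tensor f \<xi>s w) \<le> ennreal (D k)" "\<And>k. 0 \<le> D k"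
    and S: "z \<in> S" "w \<in> S"
  shows "f z \<le> f w + (\<Sum>k=1..m. D k / fact k * N (z - w) ^ k) + L / fact (Suc m) * N (z - w) ^ Suc m"
proof (cases "z = w")
  case True
  then show ?thesis
    using is_normD(2)[OF assms(1), of 0] by (simp add: sum.neutral)
next
  case False
  define \<xi> where "\<xi> = (z - w) /\<^sub>R N (z - w)"
  note seg = directions_segment[OF assms(1,3) S False, folded \<xi>_def]
  define T where "T = N (z - w)"
  \<comment> \<open>Only the diagonal values of the tensors enter, with the same unit vector in
    every slot; they are the derivatives of \<open>g 0\<close>.\<close>
  define g where "g k t = D_tensor f (replicate k \<xi>) (w + t *\<^sub>R \<xi>)" for k t
  have deriv: "(g k has_real_derivative g (Suc k) t) (at t)" if "k \<le> m" "0 \<le> t" "t \<le> T" for k t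
    unfolding g_def replicate_Suc
    using that seg assms(2,4) by (intro D_tensor_line[of S "Suc m"]) (auto simp: T_def)
  have "\<exists>t. 0 < t \<and> t < T \<and>
      g 0 T = (\<Sum>k<Suc m. (g k 0 / fact k) * T ^ k) + (g (Suc m) t / fact (Suc m)) * T ^ Suc m"
    using deriv seg(4) by (intro Maclaurin) (auto simp: T_def)
  then obtain t where t: "0 < t" "t < T" and
    eq: "g 0 T = (\<Sum>k<Suc m. (g k 0 / fact k) * T ^ k) + (g (Suc m) t / fact (Suc m)) * T ^ Suc m"
    by blast
  \<comment> \<open>Since \<open>N \<xi> = 1\<close>, the function \<open>g m\<close> is
    \<open>L\<close>-Lipschitz along the line, and \<open>g (Suc m) t\<close> is its derivative at
    an interior parameter.\<close>
  have "\<bar>g (Suc m) t\<bar> \<le> L"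
  proof (rule DERIV_abs_le_lipschitz)
    show "(g m has_real_derivative g (Suc m) t) (at t)"
      using t by (intro deriv) auto
    have tS: "w + t *\<^sub>R \<xi> \<in> S"
      using t by (intro seg) (auto simp: T_def)
    have "\<forall>\<^sub>F s in at t. w + s *\<^sub>R \<xi> \<in> S"
      using eventually_line_in[OF assms(2) seg(1) tS] by (auto simp: eventually_at_filter elim: eventually_mono)
    then show "\<forall>\<^sub>F s in at t. \<bar>g m s - g m t\<bar> \<le> L * \<bar>s - t\<bar>"
    proof eventually_elim
      case (elim s)
      show ?case
      proof (cases "s = t")
        case False
        have "\<xi> \<noteq> 0"
          using seg(2) is_normD(2)[OF assms(1), of \<xi>] by auto
        then have ne: "w + s *\<^sub>R \<xi> \<noteq> w + t *\<^sub>R \<xi>"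
          using False by simp
        have "ennreal \<bar>g m s - g m t\<bar> \<le> tensor_norm N (directions S) m
            (\<lambda>\<xi>s. D_tensor f \<xi>s (w + s *\<^sub>R \<xi>) - D_tensor f \<xi>s (w + t *\<^sub>R \<xi>))"
          unfolding g_def using seg by (intro tensor_norm_upper) auto
        also have "\<dots> \<le> ennreal (L * N ((w + s *\<^sub>R \<xi>) - (w + t *\<^sub>R \<xi>)))"
          by (intro L elim tS ne)
        also have "(w + s *\<^sub>R \<xi>) - (w + t *\<^sub>R \<xi>) = (s - t) *\<^sub>R \<xi>"
          by (simp add: algebra_simps)
        finally show ?thesis
          using seg(2) L(2) by (simp add: is_normD(3)[OF assms(1)])
      qed simp
    qed
  qed
  then have "(g (Suc m) t / fact (Suc m)) * T ^ Suc m \<le> L / fact (Suc m) * T ^ Suc m"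
    using t by (intro mult_right_mono divide_right_mono) (auto simp: abs_le_iff)
  moreover have "(g k 0 / fact k) * T ^ k \<le> D k / fact k * T ^ k" if "k \<in> {1..m}" for k
  proof -
    have "ennreal \<bar>g k 0\<bar> \<le> tensor_norm N (directions S) k (\<lambda>\<xi>s. D_tensor f \<xi>s w)"
      unfolding g_def using seg by (simp only: scaleR_zero_left add_0_right)
        (intro tensor_norm_upper, auto)
    also have "\<dots> \<le> ennreal (D k)"
      by (rule D(1)[OF that])
    finally have "\<bar>g k 0\<bar> \<le> D k"
      using D(2) by simp
    then show ?thesis
      using t by (intro mult_right_mono divide_right_mono) (auto simp: abs_le_iff)
  qed
  then have "(\<Sum>k=1..m. (g k 0 / fact k) * T ^ k) \<le> (\<Sum>k=1..m. D k / fact k * T ^ k)"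
    by (rule sum_mono)
  moreover have "(\<Sum>k<Suc m. (g k 0 / fact k) * T ^ k) = g 0 0 + (\<Sum>k=1..m. (g k 0 / fact k) * T ^ k)"
    by (subst sum.lessThan_Suc_shift) (simp add: sum.atLeast1_atMost_eq)
  moreover have "g 0 T = f z" "g 0 0 = f w"
    using seg(3) by (simp_all add: g_def T_def)
  ultimately show ?thesis
    using eq unfolding T_def by linarith
qed

section \<open>Couplings, measurability and integral inequalities\<close>

lemma distributions_onD:
  assumes "Q \<in> distributions_on Z"
  shows "prob_space Q" "sets Q = sets (restrict_space borel Z)" "space Q = Z"
  using assms sets_eq_imp_space_eq[of Q "restrict_space borel Z"]
  by (auto simp: distributions_on_def space_restrict_space)

lemma measurable_distributions_on:
  assumes "Q \<in> distributions_on Z"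
  shows "measurable Q M = measurable (restrict_space borel Z) M"
  by (intro measurable_cong_sets distributions_onD(2)[OF assms] refl)

lemma couplingsD:
  assumes "\<pi> \<in> couplings Q P"
  shows "prob_space \<pi>" "fst \<in> measurable \<pi> Q" "snd \<in> measurable \<pi> P"
    and "space \<pi> = space Q \<times> space P"
    and "f \<in> borel_measurable Q \<Longrightarrow> (\<integral>\<^sup>+x. f (fst x) \<partial>\<pi>) = (\<integral>\<^sup>+x. f x \<partial>Q)"
    and "g \<in> borel_measurable P \<Longrightarrow> (\<integral>\<^sup>+x. g (snd x) \<partial>\<pi>) = (\<integral>\<^sup>+x. g x \<partial>P)"
proof -
  have \<pi>: "prob_space \<pi>" "sets \<pi> = sets (Q \<Otimes>\<^sub>M P)" "distr \<pi> Q fst = Q" "distr \<pi> P snd = P"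
    using assms by (auto simp: couplings_def)
  show "prob_space \<pi>"
    by fact
  show m: "fst \<in> measurable \<pi> Q" "snd \<in> measurable \<pi> P"
    by (simp_all add: measurable_cong_sets[OF \<pi>(2) refl])
  show "space \<pi> = space Q \<times> space P"
    using sets_eq_imp_space_eq[OF \<pi>(2)] by (simp add: space_pair_measure)
  show "(\<integral>\<^sup>+x. f (fst x) \<partial>\<pi>) = (\<integral>\<^sup>+x. f x \<partial>Q)" if "f \<in> borel_measurable Q" for f
    using nn_integral_distr[OF m(1), of f] that by (simp add: \<pi>)
  show "(\<integral>\<^sup>+x. g (snd x) \<partial>\<pi>) = (\<integral>\<^sup>+x. g x \<partial>P)" if "g \<in> borel_measurable P" for g
    using nn_integral_distr[OF m(2), of g] that by (simp add: \<pi>)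
qed

text \<open>A supremum of uncountably many continuous functions is still lower semicontinuous.\<close>

lemma tensor_norm_measurable:
  fixes T :: "'a::topological_space list \<Rightarrow> 'a \<Rightarrow> real"
  assumes "\<And>\<xi>s. length \<xi>s = k \<Longrightarrow> set \<xi>s \<subseteq> V \<Longrightarrow> continuous_on Z (T \<xi>s)"
  shows "(\<lambda>z. tensor_norm N V k (\<lambda>\<xi>s. T \<xi>s z)) \<in> borel_measurable (restrict_space borel Z)"
proof (rule borel_measurableI_greater)
  fix y :: ennreal
  let ?I = "{\<xi>s. length \<xi>s = k \<and> (\<forall>\<xi>\<in>set \<xi>s. \<xi> \<in> V \<and> N \<xi> \<le> 1)}"
  have "openin (top_of_set Z) (Z \<inter> (\<lambda>z. ennreal \<bar>T \<xi>s z\<bar>) -` {y<..})" if "\<xi>s \<in> ?I" for \<xi>s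
    using that by (intro continuous_openin_preimage_gen continuous_on_ennreal continuous_intros assms) auto
  then have "openin (top_of_set Z) (\<Union>\<xi>s\<in>?I. Z \<inter> (\<lambda>z. ennreal \<bar>T \<xi>s z\<bar>) -` {y<..})"
    by blast
  also have "(\<Union>\<xi>s\<in>?I. Z \<inter> (\<lambda>z. ennreal \<bar>T \<xi>s z\<bar>) -` {y<..})
      = {z \<in> Z. y < tensor_norm N V k (\<lambda>\<xi>s. T \<xi>s z)}"
    unfolding tensor_norm_def by (auto simp: less_SUP_iff)
  finally obtain U where "open U" "{z \<in> Z. y < tensor_norm N V k (\<lambda>\<xi>s. T \<xi>s z)} = Z \<inter> U"
    by (auto simp: openin_open)
  then show "{z \<in> space (restrict_space borel Z). y < tensor_norm N V k (\<lambda>\<xi>s. T \<xi>s z)}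
      \<in> sets (restrict_space borel Z)"
    by (auto simp: space_restrict_space sets_restrict_space)
qed

text \<open>Hoelder's inequality with upper bounds \<open>a\<close> and \<open>b\<close> in place of
  the two integrals. Strict positivity of the bounds permits division by their roots, so vanishing
  integrals require no separate case.\<close>

lemma nn_integral_holder_le:
  fixes g h :: "'a \<Rightarrow> real"
  assumes [measurable]: "g \<in> borel_measurable M" "h \<in> borel_measurable M"
    and nn: "\<And>x. 0 \<le> g x" "\<And>x. 0 \<le> h x"
    and pq: "1 < p" "1 < q" "1 / p + 1 / q = 1"
    and a: "0 < a" "(\<integral>\<^sup>+x. ennreal (g x powr p) \<partial>M) \<le> ennreal a"
    and b: "0 < b" "(\<integral>\<^sup>+x. ennreal (h x powr q) \<partial>M) \<le> ennreal b"
  shows "(\<integral>\<^sup>+x. ennreal (g x * h x) \<partial>M) \<le> ennreal (a powr (1 / p) * b powr (1 / q))"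
proof -
  define c where "c = a powr (1 / p) * b powr (1 / q)"
  have c: "0 < c"
    using a b by (simp add: c_def)
  have young: "g x * h x \<le> c / (p * a) * g x powr p + c / (q * b) * h x powr q" for x
  proof -
    \<comment> \<open>After this normalization the two terms on the right integrate to at most
      \<open>1 / p\<close> and \<open>1 / q\<close>, which add up to \<open>1\<close>.\<close>
    have "(g x / a powr (1 / p)) * (h x / b powr (1 / q))
        \<le> (g x / a powr (1 / p)) powr p / p + (h x / b powr (1 / q)) powr q / q"
      using nn by (intro Youngs_inequality pq) auto
    also have "\<dots> = g x powr p / (p * a) + h x powr q / (q * b)"
      using a b pq nn by (simp add: powr_divide powr_powr mult.commute)
    finally have "c * ((g x * h x) / c) \<le> c * (g x powr p / (p * a) + h x powr q / (q * b))"
      using c by (intro mult_left_mono) (auto simp: c_def)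
    then show ?thesis
      using c by (simp add: algebra_simps)
  qed
  have pos: "0 \<le> c / (p * a)" "0 \<le> c / (q * b)"
    using c pq a b by auto
  have "(\<integral>\<^sup>+x. ennreal (g x * h x) \<partial>M)
      \<le> (\<integral>\<^sup>+x. ennreal (c / (p * a)) * ennreal (g x powr p) + ennreal (c / (q * b)) * ennreal (h x powr q) \<partial>M)"
  proof (rule nn_integral_mono)
    fix x
    have "ennreal (g x * h x) \<le> ennreal (c / (p * a) * g x powr p + c / (q * b) * h x powr q)"
      by (intro ennreal_leI young)
    then show "ennreal (g x * h x)
        \<le> ennreal (c / (p * a)) * ennreal (g x powr p) + ennreal (c / (q * b)) * ennreal (h x powr q)"
      by (simp only: ennreal_plus ennreal_mult pos powr_ge_zero mult_nonneg_nonneg)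
  qed
  also have "\<dots> = ennreal (c / (p * a)) * (\<integral>\<^sup>+x. ennreal (g x powr p) \<partial>M)
      + ennreal (c / (q * b)) * (\<integral>\<^sup>+x. ennreal (h x powr q) \<partial>M)"
    by (simp add: nn_integral_add nn_integral_cmult)
  also have "\<dots> \<le> ennreal (c / (p * a)) * ennreal a + ennreal (c / (q * b)) * ennreal b"
    by (intro add_mono mult_left_mono a b) auto
  also have "\<dots> = ennreal (c / p + c / q)"
    using pos a b pq c by (simp flip: ennreal_mult ennreal_plus)
  also have "c / p + c / q = c * (1 / p + 1 / q)"
    by (simp add: algebra_simps)
  finally show ?thesis
    using pq(3) by (simp add: c_def)
qed

text \<open>Used to change the base point of a moment and to carry a moment from one marginal of a
  coupling to the other.\<close>

lemma nn_integral_norm_power_add: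
  fixes X Y :: "'b \<Rightarrow> 'a::euclidean_space"
  assumes "is_norm N" and [measurable]: "X \<in> borel_measurable M" "Y \<in> borel_measurable M"
    and "(\<integral>\<^sup>+x. ennreal (N (X x) ^ n) \<partial>M) < \<infinity>" "(\<integral>\<^sup>+x. ennreal (N (Y x) ^ n) \<partial>M) < \<infinity>"
  shows "(\<integral>\<^sup>+x. ennreal (N (X x + Y x) ^ n) \<partial>M) < \<infinity>"
proof -
  have [measurable]: "N \<in> borel_measurable borel"
    by (intro borel_measurable_continuous_onI is_norm_continuous assms)
  have "(\<integral>\<^sup>+x. ennreal (N (X x + Y x) ^ n) \<partial>M)
      \<le> (\<integral>\<^sup>+x. ennreal (2 ^ n) * (ennreal (N (X x) ^ n) + ennreal (N (Y x) ^ n)) \<partial>M)"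
    using is_norm_power_le[OF assms(1)]
    by (intro nn_integral_mono)
      (simp flip: ennreal_mult ennreal_plus add: is_normD(1)[OF assms(1)] ennreal_leI)
  also have "\<dots> = ennreal (2 ^ n) * ((\<integral>\<^sup>+x. ennreal (N (X x) ^ n) \<partial>M) + (\<integral>\<^sup>+x. ennreal (N (Y x) ^ n) \<partial>M))"
    by (simp add: nn_integral_add nn_integral_cmult)
  also have "\<dots> < \<infinity>"
    using assms(4,5) by (simp add: ennreal_mult_less_top)
  finally show ?thesis .
qed

section \<open>Integrating the Taylor bound against a coupling\<close>

text \<open>Here \<open>Suc m\<close> stands for the exponent of the cost. The exponents of the
  \<open>k\<close>-th Hoelder estimate are conjugate because their reciprocals are
  \<open>(Suc m - k) / Suc m\<close> and \<open>k / Suc m\<close>.\<close>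

lemma coupling_taylor_bound:
  fixes f N :: "'a::euclidean_space \<Rightarrow> real" and a :: "nat \<Rightarrow> real"
  assumes Q: "Q \<in> distributions_on Z" and P: "P \<in> distributions_on Z"
    and \<pi>: "\<pi> \<in> couplings Q P" and N: "is_norm N"
    and f: "f \<in> borel_measurable (restrict_space borel Z)"
    and D: "\<And>k. k \<in> {1..m} \<Longrightarrow> D k \<in> borel_measurable (restrict_space borel Z)" "\<And>k z. 0 \<le> D k z"
    and K: "0 \<le> K"
    and taylor: "\<And>z w. z \<in> Z \<Longrightarrow> w \<in> Z \<Longrightarrow>
      f z \<le> f w + (\<Sum>k=1..m. D k w / fact k * N (z - w) ^ k) + K * N (z - w) ^ Suc m"
    and b: "0 < b" "(\<integral>\<^sup>+x. ennreal (N (fst x - snd x) ^ Suc m) \<partial>\<pi>) \<le> ennreal b"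
    and a: "\<And>k. k \<in> {1..m} \<Longrightarrow> 0 < a k"
      "\<And>k. k \<in> {1..m} \<Longrightarrow>
        (\<integral>\<^sup>+z. ennreal (D k z powr (real (Suc m) / real (Suc m - k))) \<partial>P) \<le> ennreal (a k)"
  shows "(\<integral>\<^sup>+z. ennreal (f z) \<partial>Q) + (\<integral>\<^sup>+z. ennreal (- f z) \<partial>P)
    \<le> (\<integral>\<^sup>+z. ennreal (f z) \<partial>P) + (\<integral>\<^sup>+z. ennreal (- f z) \<partial>Q)
      + ennreal ((\<Sum>k=1..m. a k powr (1 / (real (Suc m) / real (Suc m - k)))
                     * b powr (1 / (real (Suc m) / real k)) / fact k) + K * b)"
proof -
  note \<pi>D = couplingsD[OF \<pi>]
  have [measurable]: "fst \<in> measurable \<pi> Q" "snd \<in> measurable \<pi> P"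
    by (fact \<pi>D)+
  have [measurable]: "N \<in> borel_measurable borel"
    by (intro borel_measurable_continuous_onI is_norm_continuous N)
  have ident: "(\<lambda>z. z) \<in> borel_measurable Q" "(\<lambda>z. z) \<in> borel_measurable P"
    by (simp_all add: measurable_distributions_on[OF Q] measurable_distributions_on[OF P]
        measurable_restrict_space1)
  have [measurable]: "f \<in> borel_measurable P" "f \<in> borel_measurable Q"
    using f by (simp_all add: measurable_distributions_on[OF Q] measurable_distributions_on[OF P])
  have mD[measurable]: "D k \<in> borel_measurable P" if "k \<in> {1..m}" for k
    using D(1)[OF that] by (simp add: measurable_distributions_on[OF P])
  have [measurable]: "fst \<in> borel_measurable \<pi>" "snd \<in> borel_measurable \<pi>"
    using measurable_compose[OF \<pi>D(2) ident(1)] measurable_compose[OF \<pi>D(3) ident(2)] by simp_all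
  define T where "T x = N (fst x - snd x)" for x :: "'a \<times> 'a"
  have T[measurable]: "T \<in> borel_measurable \<pi>" and T0: "0 \<le> T x" for x
    unfolding T_def by simp_all (simp add: is_normD(1)[OF N])
  have holder: "(\<integral>\<^sup>+x. ennreal (D k (snd x) * T x ^ k) \<partial>\<pi>)
      \<le> ennreal (a k powr (1 / (real (Suc m) / real (Suc m - k))) * b powr (1 / (real (Suc m) / real k)))"
    if k: "k \<in> {1..m}" for k
  proof (rule nn_integral_holder_le)
    note [measurable] = mD[OF k]
    show "(\<lambda>x. D k (snd x)) \<in> borel_measurable \<pi>" "(\<lambda>x. T x ^ k) \<in> borel_measurable \<pi>"
      by measurable
    show "(\<integral>\<^sup>+x. ennreal (D k (snd x) powr (real (Suc m) / real (Suc m - k))) \<partial>\<pi>) \<le> ennreal (a k)"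
      using a(2)[OF k] by (subst \<pi>D(6)) auto
    \<comment> \<open>Passing between \<open>^\<close> and \<open>powr\<close> requires a positive
      base; at \<open>T x = 0\<close> both sides vanish because \<open>k\<close> is
      positive.\<close>
    have "(T x ^ k) powr (real (Suc m) / real k) = T x ^ Suc m" for x
    proof (cases "T x = 0")
      case False
      then have "0 < T x"
        using T0[of x] by simp
      then have "(T x ^ k) powr (real (Suc m) / real k) = (T x powr real k) powr (real (Suc m) / real k)"
        by (simp only: powr_realpow)
      also have "\<dots> = T x powr real (Suc m)"
        using k by (simp add: powr_powr del: of_nat_Suc)
      also have "\<dots> = T x ^ Suc m"
        using \<open>0 < T x\<close> by (simp only: powr_realpow)
      finally show ?thesis .
    qed (use k in auto)
    then show "(\<integral>\<^sup>+x. ennreal ((T x ^ k) powr (real (Suc m) / real k)) \<partial>\<pi>) \<le> ennreal b"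
      using b(2) by (simp add: T_def)
    show "1 / (real (Suc m) / real (Suc m - k)) + 1 / (real (Suc m) / real k) = 1"
      using k by (simp add: of_nat_diff flip: add_divide_distrib del: of_nat_Suc)
  qed (use k a b D T0 in \<open>auto simp: less_divide_eq of_nat_diff\<close>)
  have "(\<integral>\<^sup>+z. ennreal (f z) \<partial>Q) + (\<integral>\<^sup>+z. ennreal (- f z) \<partial>P)
      = (\<integral>\<^sup>+x. ennreal (f (fst x)) + ennreal (- f (snd x)) \<partial>\<pi>)"
    by (simp add: nn_integral_add \<pi>D(5)[of "\<lambda>z. ennreal (f z)"] \<pi>D(6)[of "\<lambda>z. ennreal (- f z)"])
  also have "\<dots> \<le> (\<integral>\<^sup>+x. (ennreal (f (snd x)) + ennreal (- f (fst x)))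
      + ((\<Sum>k=1..m. ennreal (1 / fact k) * ennreal (D k (snd x) * T x ^ k)) + ennreal K * ennreal (T x ^ Suc m)) \<partial>\<pi>)"
  proof (rule nn_integral_mono)
    fix x assume "x \<in> space \<pi>"
    then have x: "fst x \<in> Z" "snd x \<in> Z"
      by (auto simp: \<pi>D(4) distributions_onD(3)[OF Q] distributions_onD(3)[OF P])
    define R where "R = (\<Sum>k=1..m. (1 / fact k) * (D k (snd x) * T x ^ k)) + K * T x ^ Suc m"
    have "f (fst x) \<le> f (snd x) + R"
      using taylor[OF x] by (simp add: R_def T_def)
    moreover have "0 \<le> R"
      unfolding R_def using K T0 D(2) by (intro add_nonneg_nonneg sum_nonneg mult_nonneg_nonneg) auto
    \<comment> \<open>\<open>ennreal\<close> truncates at zero, so these terms are positive and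
      negative parts. Writing \<open>f\<close> as their difference and moving the negative parts
      across turns the real inequality into one between nonnegative quantities.\<close>
    ultimately have "ennreal (f (fst x)) + ennreal (- f (snd x))
        \<le> (ennreal (f (snd x)) + ennreal (- f (fst x))) + ennreal R"
      by (cases "0 \<le> f (fst x)"; cases "0 \<le> f (snd x)")
        (simp_all add: ennreal_neg flip: ennreal_plus)
    also have "ennreal R = (\<Sum>k=1..m. ennreal (1 / fact k) * ennreal (D k (snd x) * T x ^ k))
        + ennreal K * ennreal (T x ^ Suc m)"
    proof -
      have "0 \<le> 1 / fact k * (D k (snd x) * T x ^ k)" for k
        using T0 D(2) by simp
      then have "ennreal R = (\<Sum>k=1..m. ennreal ((1 / fact k) * (D k (snd x) * T x ^ k))) + ennreal (K * T x ^ Suc m)"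
        unfolding R_def using K T0 by (subst ennreal_plus) (auto intro!: sum_nonneg simp: sum_ennreal)
      then show ?thesis
        using K T0 D(2) by (simp only: ennreal_mult mult_nonneg_nonneg zero_le_power zero_le_divide_1_iff fact_ge_zero)
    qed
    finally show "ennreal (f (fst x)) + ennreal (- f (snd x)) \<le> (ennreal (f (snd x)) + ennreal (- f (fst x)))
      + ((\<Sum>k=1..m. ennreal (1 / fact k) * ennreal (D k (snd x) * T x ^ k)) + ennreal K * ennreal (T x ^ Suc m))" .
  qed
  also have "\<dots> = ((\<integral>\<^sup>+z. ennreal (f z) \<partial>P) + (\<integral>\<^sup>+z. ennreal (- f z) \<partial>Q))
      + ((\<Sum>k=1..m. ennreal (1 / fact k) * (\<integral>\<^sup>+x. ennreal (D k (snd x) * T x ^ k) \<partial>\<pi>))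
          + ennreal K * (\<integral>\<^sup>+x. ennreal (T x ^ Suc m) \<partial>\<pi>))"
  proof -
    \<comment> \<open>Measurability of \<open>D k\<close> is available only for \<open>k\<close> in
      the summation range, so it is supplied summand by summand.\<close>
    have mT: "(\<lambda>x. ennreal (D k (snd x) * T x ^ k)) \<in> borel_measurable \<pi>" if "k \<in> {1..m}" for k
    proof -
      note [measurable] = mD[OF that]
      show ?thesis
        by measurable
    qed
    have mS: "(\<lambda>x. \<Sum>k=1..m. ennreal (1 / fact k) * ennreal (D k (snd x) * T x ^ k)) \<in> borel_measurable \<pi>"
      by (intro borel_measurable_sum borel_measurable_times_ennreal borel_measurable_const mT)
    have "(\<integral>\<^sup>+x. (\<Sum>k=1..m. ennreal (1 / fact k) * ennreal (D k (snd x) * T x ^ k)) \<partial>\<pi>)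
        = (\<Sum>k=1..m. ennreal (1 / fact k) * (\<integral>\<^sup>+x. ennreal (D k (snd x) * T x ^ k) \<partial>\<pi>))"
      using mT by (subst nn_integral_sum) (auto intro!: sum.cong nn_integral_cmult)
    then show ?thesis
      using mS by (simp add: nn_integral_add nn_integral_cmult
          \<pi>D(5)[of "\<lambda>z. ennreal (- f z)"] \<pi>D(6)[of "\<lambda>z. ennreal (f z)"] del: power_Suc)
  qed
  also have "\<dots> \<le> ((\<integral>\<^sup>+z. ennreal (f z) \<partial>P) + (\<integral>\<^sup>+z. ennreal (- f z) \<partial>Q))
      + ((\<Sum>k=1..m. ennreal (1 / fact k) * ennreal (a k powr (1 / (real (Suc m) / real (Suc m - k)))
            * b powr (1 / (real (Suc m) / real k)))) + ennreal K * ennreal b)"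
    using b(2) by (intro add_mono sum_mono mult_left_mono holder) (auto simp: T_def)
  also have "(\<Sum>k=1..m. ennreal (1 / fact k) * ennreal (a k powr (1 / (real (Suc m) / real (Suc m - k)))
            * b powr (1 / (real (Suc m) / real k)))) + ennreal K * ennreal b
      = ennreal ((\<Sum>k=1..m. a k powr (1 / (real (Suc m) / real (Suc m - k)))
                     * b powr (1 / (real (Suc m) / real k)) / fact k) + K * b)"
    using K b(1) by (simp add: sum_nonneg flip: ennreal_mult ennreal_plus)
  finally show ?thesis .
qed

text \<open>The slack \<open>\<delta>\<close> makes the bound on the infimum strict, hence some
  coupling stays below it.\<close>

lemma ot_cost_le_imp_coupling:
  assumes "ot_cost c Q P \<le> ennreal \<epsilon>" "0 < \<delta>" "0 \<le> \<epsilon>"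
  obtains \<pi> where "\<pi> \<in> couplings Q P" "(\<integral>\<^sup>+(z, w). c z w \<partial>\<pi>) \<le> ennreal (\<epsilon> + \<delta>)"
proof -
  have "ot_cost c Q P < ennreal (\<epsilon> + \<delta>)"
    using assms by (intro le_less_trans[OF assms(1)]) (auto simp: ennreal_less_iff)
  then show ?thesis
    unfolding ot_cost_def INF_less_iff by (auto intro: that less_imp_le)
qed

section \<open>Lipschitz modulus and growth of the derivatives\<close>

text \<open>Divides the mean value estimate of \<open>D_tensor_lipschitz\<close> by the positive
  distance. This makes the last term of the final bound finite.\<close>

lemma deriv_lip_le:
  fixes loss :: "'a::euclidean_space \<Rightarrow> ereal"
  assumes "is_norm N" "convex (edom loss)" "Ck_on (Suc k) (rdom loss) (\<lambda>z. real_of_ereal (loss z))"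
    and "\<And>z. z \<in> rdom loss \<Longrightarrow> deriv_norm N loss (Suc k) z \<le> ennreal G" "0 \<le> G"
  shows "deriv_lip N loss k \<le> ennreal G"
  unfolding deriv_lip_def
proof (rule SUP_least, clarsimp)
  fix z w assume zw: "z \<in> rdom loss" "w \<in> rdom loss" "z \<noteq> w"
  have S: "rel_open (rdom loss)" "convex (rdom loss)"
    using assms(2) by (auto simp: rel_interior_rel_open convex_rel_interior)
  have "tensor_norm N (directions (rdom loss)) k (\<lambda>\<xi>s. D_tensor (\<lambda>x. real_of_ereal (loss x)) \<xi>s z
      - D_tensor (\<lambda>x. real_of_ereal (loss x)) \<xi>s w) \<le> ennreal (G * N (z - w))"
    using assms zw S by (intro D_tensor_lipschitz) (auto simp: deriv_norm_def)
  also have "\<dots> = ennreal (N (z - w)) * ennreal G"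
    using assms by (simp add: is_normD(1) ennreal_mult mult.commute)
  finally show "tensor_norm N (directions (rdom loss)) k (\<lambda>\<xi>s. D_tensor (\<lambda>x. real_of_ereal (loss x)) \<xi>s z
      - D_tensor (\<lambda>x. real_of_ereal (loss x)) \<xi>s w) / ennreal (N (z - w)) \<le> ennreal G"
    using directions_segment(4)[OF assms(1) S(2) zw] by (intro divide_le_posI_ennreal) auto
qed

text \<open>Clears the denominator in \<open>deriv_lip\<close>; the cancellation in
  \<open>ennreal\<close> is valid because the distance is positive and finite.\<close>

lemma tensor_norm_diff_le_deriv_lip:
  fixes loss :: "'a::euclidean_space \<Rightarrow> ereal"
  assumes "is_norm N" "z \<in> rdom loss" "w \<in> rdom loss" "z \<noteq> w"
  shows "tensor_norm N (directions (rdom loss)) k (\<lambda>\<xi>s. D_tensor (\<lambda>x. real_of_ereal (loss x)) \<xi>s z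
      - D_tensor (\<lambda>x. real_of_ereal (loss x)) \<xi>s w) \<le> deriv_lip N loss k * ennreal (N (z - w))"
    (is "?T \<le> _")
proof -
  have pos: "0 < N (z - w)"
    using is_normD(1,2)[OF assms(1), of "z - w"] assms(4) by (auto simp: less_le)
  have "?T / ennreal (N (z - w)) \<le> deriv_lip N loss k"
    unfolding deriv_lip_def using assms by (intro SUP_upper2[of "(z, w)"]) auto
  then have "(?T / ennreal (N (z - w))) * ennreal (N (z - w)) \<le> deriv_lip N loss k * ennreal (N (z - w))"
    by (rule mult_right_mono) simp
  then show ?thesis
    using pos by (simp add: ennreal_divide_times ennreal_times_divide mult_divide_eq_ennreal)
qed

text \<open>Both \<open>1\<close> and \<open>x ^ j\<close> are at most the \<open>j\<close>-th power
  of \<open>max 1 x\<close>, so raising to the power \<open>p / j\<close> gives growth of degree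
  \<open>p\<close>. With \<open>j = p - k\<close> this is the growth allowed for the derivatives of
  order \<open>k\<close>, raised to the exponent \<open>p / (p - k)\<close>.\<close>

lemma powr_growth_bound:
  fixes x G :: real
  assumes "0 \<le> x" "0 \<le> G" "0 < j"
  shows "(G * (1 + x ^ j)) powr (real p / real j) \<le> (2 * G) powr (real p / real j) * (1 + x ^ p)"
proof -
  let ?M = "max 1 x"
  have "x ^ j \<le> ?M ^ j" "1 \<le> ?M ^ j"
    using assms by (auto intro: power_mono one_le_power)
  then have "1 + x ^ j \<le> 2 * ?M ^ j"
    by linarith
  then have "G * (1 + x ^ j) \<le> G * (2 * ?M ^ j)"
    using assms by (intro mult_left_mono) auto
  then have "(G * (1 + x ^ j)) powr (real p / real j) \<le> (2 * G * ?M ^ j) powr (real p / real j)"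
    using assms by (intro powr_mono2) auto
  also have "\<dots> = (2 * G) powr (real p / real j) * (?M powr real j) powr (real p / real j)"
    using assms by (subst powr_mult) (auto simp: powr_realpow)
  also have "(?M powr real j) powr (real p / real j) = ?M ^ p"
    using assms by (simp only: powr_powr) (simp add: powr_realpow)
  also have "(2 * G) powr (real p / real j) * ?M ^ p \<le> (2 * G) powr (real p / real j) * (1 + x ^ p)"
    using assms by (intro mult_left_mono) (auto simp: max_def)
  finally show ?thesis .
qed

text \<open>Constants have finite integral on a probability space, so a finite integral of
  \<open>h\<close> controls everything of the same growth.\<close>

lemma nn_integral_growth_finite:
  assumes "prob_space M" "h \<in> borel_measurable M" "\<And>x. 0 \<le> h x"
    and "(\<integral>\<^sup>+x. ennreal (h x) \<partial>M) < \<infinity>" "0 \<le> c"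
    and "\<And>x. x \<in> space M \<Longrightarrow> g x \<le> c * (1 + h x)"
  shows "(\<integral>\<^sup>+x. ennreal (g x) \<partial>M) < \<infinity>"
proof -
  interpret prob_space M by fact
  have "(\<integral>\<^sup>+x. ennreal (g x) \<partial>M) \<le> (\<integral>\<^sup>+x. ennreal c * (1 + ennreal (h x)) \<partial>M)"
  proof (rule nn_integral_mono)
    fix x assume "x \<in> space M"
    then have "ennreal (g x) \<le> ennreal (c * (1 + h x))"
      by (intro ennreal_leI assms)
    then show "ennreal (g x) \<le> ennreal c * (1 + ennreal (h x))"
      using assms(3,5) by (simp add: ennreal_mult)
  qed
  also have "\<dots> = ennreal c * (1 + (\<integral>\<^sup>+x. ennreal (h x) \<partial>M))"
    using assms(2) by (simp add: nn_integral_cmult nn_integral_add emeasure_space_1)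
  also have "\<dots> < \<infinity>"
    using assms(4) by (simp add: ennreal_mult_less_top)
  finally show ?thesis .
qed

section \<open>The bound on the worst-case expectation\<close>

theorem theorem3:
  fixes Z :: "'a::euclidean_space set"
    and P :: "'a measure"
    and c :: "'a \<Rightarrow> 'a \<Rightarrow> ennreal"
    and loss :: "'a \<Rightarrow> ereal"
    and N :: "'a \<Rightarrow> real"
    and p :: nat
    and \<epsilon> G :: real
    and z\<^sub>0 :: 'a
    and C :: ennreal
  assumes "Z \<noteq> {}" and "closed Z"
    and "P \<in> distributions_on Z"
    and "\<And>z z'. z \<in> Z \<Longrightarrow> z' \<in> Z \<Longrightarrow> c z z' = 0 \<longleftrightarrow> z = z'"
    and "lsc_on (Z \<times> Z) (\<lambda>(z, z'). c z z')"
    and "\<And>z. loss z \<noteq> -\<infinity>"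
    and "usc_on Z loss"
    and "integrable P (\<lambda>z. real_of_ereal (loss z))"
    and "Z \<subseteq> rdom loss"
    and "0 \<le> \<epsilon>"
    and "z\<^sub>0 \<in> Z" and "C < \<infinity>" and "(\<integral>\<^sup>+z. c z z\<^sub>0 \<partial>P) \<le> C"
    and "is_norm N" and "1 \<le> p"
    and "\<And>z z'. z \<in> Z \<Longrightarrow> z' \<in> Z \<Longrightarrow> ennreal (N (z - z') ^ p) \<le> c z z'"
    and "convex (edom loss)"
    and "Ck_on p (rdom loss) (\<lambda>z. real_of_ereal (loss z))"
    and "0 < G"
    and "\<And>z. z \<in> rdom loss \<Longrightarrow> loss z \<le> ereal (G * (1 + N z ^ p))"
    and "\<And>z k. z \<in> rdom loss \<Longrightarrow> k \<in> {1..p - 1} \<Longrightarrow>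
           deriv_norm N loss k z \<le> ennreal (G * (1 + N z ^ (p - k)))"
    and "\<And>z. z \<in> rdom loss \<Longrightarrow> deriv_norm N loss p z \<le> ennreal G"
  shows "let pk = (\<lambda>k::nat. real p / real k);
             qk = (\<lambda>k::nat. real p / real (p - k));
             bound = ext_expectation P loss
               + enn2ereal (\<Sum>k=1..p - 1. ennreal (\<epsilon> powr (1 / pk k) / fact k) *
                   enn_powr (\<integral>\<^sup>+z. enn_powr (deriv_norm N loss k z) (qk k) \<partial>P) (1 / qk k))
               + enn2ereal (ennreal (\<epsilon> / fact p) * deriv_lip N loss (p - 1))
         in (SUP Q\<in>ot_ball Z c \<epsilon> P. ext_expectation Q loss) \<le> bound \<and> bound < \<infinity>"
proof -
  note P = assms(3) and \<epsilon> = assms(10) and N = assms(14) and G = \<open>0 < G\<close>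
  obtain m where m: "p = Suc m"
    using assms(15) by (cases p) auto
  define S where "S = rdom loss"
  \<comment> \<open>\<open>real_of_ereal\<close> and \<open>enn2real\<close> send infinite values to
    \<open>0\<close>, so \<open>f\<close>, \<open>D\<close> and \<open>L\<close> represent the
    original quantities only once finiteness is established below.\<close>
  define f where "f z = real_of_ereal (loss z)" for z
  define q where "q k = real p / real (p - k)" for k
  define D where "D k z = enn2real (deriv_norm N loss k z)" for k z
  define L where "L = enn2real (deriv_lip N loss m)"
  have S: "rel_open S" "convex S" "Z \<subseteq> S"
    using assms(9,17) by (auto simp: S_def rel_interior_rel_open convex_rel_interior)
  have Ck: "Ck_on (Suc m) S f"
    using assms(18) by (simp add: S_def f_def[abs_def] m)
  have loss: "loss z = ereal (f z)" if "z \<in> S" for z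
  proof -
    have "loss z < \<infinity>"
      using that rel_interior_subset[of "edom loss"] by (auto simp: S_def edom_def)
    then show ?thesis
      using assms(6)[of z] by (cases "loss z") (auto simp: f_def)
  qed
  have fG: "f z \<le> G * (1 + N z ^ p)" if "z \<in> S" for z
    using assms(20)[of z] loss[OF that] that by (simp add: S_def)
  have dn: "deriv_norm N loss k z = tensor_norm N (directions S) k (\<lambda>\<xi>s. D_tensor f \<xi>s z)" for k z
    by (simp add: deriv_norm_def S_def f_def[abs_def])
  have deriv: "deriv_norm N loss k z = ennreal (D k z)" and DG: "D k z \<le> G * (1 + N z ^ (p - k))"
    if "z \<in> S" "k \<in> {1..m}" for z k
  proof -
    have le: "deriv_norm N loss k z \<le> ennreal (G * (1 + N z ^ (p - k)))"
      using that by (intro assms(21)) (auto simp: S_def m)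
    then show eq: "deriv_norm N loss k z = ennreal (D k z)"
      unfolding D_def using le_less_trans[OF le] by (intro ennreal_enn2real[symmetric]) simp
    show "D k z \<le> G * (1 + N z ^ (p - k))"
      using le G by (simp add: eq is_normD(1)[OF N])
  qed
  have D0: "0 \<le> D k z" for k z
    by (simp add: D_def)
  \<comment> \<open>The bound \<open>G\<close> on the derivatives of order \<open>p\<close> is used
    only for finiteness; the Taylor remainder keeps the sharper constant \<open>L\<close>.\<close>
  have "deriv_lip N loss m \<le> ennreal G"
    using assms(18,22) G by (intro deriv_lip_le N assms(17)) (auto simp: m)
  then have lip: "deriv_lip N loss m = ennreal L"
    unfolding L_def using le_less_trans by (intro ennreal_enn2real[symmetric]) fastforce
  have L0: "0 \<le> L"
    by (simp add: L_def)
  have taylor: "f z \<le> f w + (\<Sum>k=1..m. D k w / fact k * N (z - w) ^ k) + L / fact (Suc m) * N (z - w) ^ Suc m"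
    if zw: "z \<in> Z" "w \<in> Z" for z w
  proof (rule taylor_upper_bound[OF N S(1,2) Ck _ L0 _ D0])
    fix x y assume "x \<in> S" "y \<in> S" "x \<noteq> y"
    then show "tensor_norm N (directions S) m (\<lambda>\<xi>s. D_tensor f \<xi>s x - D_tensor f \<xi>s y) \<le> ennreal (L * N (x - y))"
      using tensor_norm_diff_le_deriv_lip[OF N, of x loss y m] lip L0
      by (simp add: S_def f_def[abs_def] ennreal_mult is_normD(1)[OF N])
  next
    fix k assume "k \<in> {1..m}"
    then show "tensor_norm N (directions S) k (\<lambda>\<xi>s. D_tensor f \<xi>s w) \<le> ennreal (D k w)"
      using zw S(3) deriv[of w k] by (auto simp: dn)
  qed (use zw S in auto)
  have f_meas: "f \<in> borel_measurable (restrict_space borel Z)"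
    using Ck_on_imp_continuous_on[OF Ck] S(3)
    by (intro borel_measurable_continuous_on_restrict) (rule continuous_on_subset)
  have D_meas: "D k \<in> borel_measurable (restrict_space borel Z)" if "k \<in> {1..m}" for k
  proof -
    have "(\<lambda>z. tensor_norm N (directions S) k (\<lambda>\<xi>s. D_tensor f \<xi>s z)) \<in> borel_measurable (restrict_space borel Z)"
      using that S(3)
      by (intro tensor_norm_measurable continuous_on_subset[OF continuous_on_D_tensor[OF Ck]]) auto
    then show ?thesis
      unfolding D_def[abs_def] dn by measurable
  qed
  have [measurable]: "N \<in> borel_measurable borel"
    by (intro borel_measurable_continuous_onI is_norm_continuous N)
  have borel: "g \<in> measurable Q M" if "Q \<in> distributions_on Z" "g \<in> measurable borel M"
    for Q M and g :: "'a \<Rightarrow> 'b"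
    using that by (simp add: measurable_distributions_on measurable_restrict_space1)
  interpret P: prob_space P
    by (rule distributions_onD[OF P])
  \<comment> \<open>The cost to \<open>z\<^sub>0\<close> dominates the \<open>p\<close>-th power of
    the distance, and the base point is then moved from \<open>z\<^sub>0\<close> to the
    origin.\<close>
  have P_moment: "(\<integral>\<^sup>+z. ennreal (N z ^ p) \<partial>P) < \<infinity>"
  proof -
    have "(\<integral>\<^sup>+z. ennreal (N (z - z\<^sub>0) ^ p) \<partial>P) \<le> (\<integral>\<^sup>+z. c z z\<^sub>0 \<partial>P)"
      using assms(11,16) by (intro nn_integral_mono) (auto simp: distributions_onD(3)[OF P])
    also have "\<dots> < \<infinity>"
      using assms(12,13) by (rule le_less_trans[rotated])
    finally have "(\<integral>\<^sup>+z. ennreal (N ((z - z\<^sub>0) + z\<^sub>0) ^ p) \<partial>P) < \<infinity>"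
      by (intro nn_integral_norm_power_add[OF N] borel[OF P]) (auto simp: P.emeasure_space_1)
    then show ?thesis
      by simp
  qed
  define A where "A k = enn2real (\<integral>\<^sup>+z. enn_powr (deriv_norm N loss k z) (q k) \<partial>P)" for k
  have A: "(\<integral>\<^sup>+z. enn_powr (deriv_norm N loss k z) (q k) \<partial>P) = ennreal (A k)"
    "(\<integral>\<^sup>+z. ennreal (D k z powr q k) \<partial>P) = ennreal (A k)" if k: "k \<in> {1..m}" for k
  proof -
    have eq: "(\<integral>\<^sup>+z. enn_powr (deriv_norm N loss k z) (q k) \<partial>P) = (\<integral>\<^sup>+z. ennreal (D k z powr q k) \<partial>P)"
    proof (rule nn_integral_cong)
      fix z assume "z \<in> space P"
      then have "z \<in> S"
        using S(3) by (auto simp: distributions_onD(3)[OF P])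
      then show "enn_powr (deriv_norm N loss k z) (q k) = ennreal (D k z powr q k)"
        using D0 by (simp add: deriv[OF _ k] enn_powr_def)
    qed
    have "(\<integral>\<^sup>+z. ennreal (D k z powr q k) \<partial>P) < \<infinity>"
    proof (rule nn_integral_growth_finite[OF P.prob_space_axioms _ _ P_moment])
      fix z assume "z \<in> space P"
      then have "z \<in> S"
        using S(3) by (auto simp: distributions_onD(3)[OF P])
      then have "D k z powr q k \<le> (G * (1 + N z ^ (p - k))) powr q k"
        using DG[OF _ k] D0 by (intro powr_mono2) (auto simp: q_def)
      also have "\<dots> \<le> (2 * G) powr q k * (1 + N z ^ p)"
        unfolding q_def using G k by (intro powr_growth_bound is_normD(1)[OF N]) (auto simp: m)
      finally show "D k z powr q k \<le> (2 * G) powr q k * (1 + N z ^ p)" .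
    qed (use is_normD(1)[OF N] in \<open>auto intro!: borel[OF P]\<close>)
    then show "(\<integral>\<^sup>+z. enn_powr (deriv_norm N loss k z) (q k) \<partial>P) = ennreal (A k)"
      by (simp add: A_def eq)
    then show "(\<integral>\<^sup>+z. ennreal (D k z powr q k) \<partial>P) = ennreal (A k)"
      by (simp add: eq)
  qed
  have A0: "0 \<le> A k" for k
    by (simp add: A_def)
  \<comment> \<open>\<open>r 0\<close> is the sum of all error terms in the claim. Adding
    \<open>\<delta>\<close> to both \<open>A k\<close> and \<open>\<epsilon>\<close> makes the
    bounds in Hoelder's inequality strictly positive, even if a derivative moment or the radius
    vanishes.\<close>
  define r where "r \<delta> = (\<Sum>k=1..m. (A k + \<delta>) powr (1 / q k) * (\<epsilon> + \<delta>) powr (1 / (real p / real k)) / fact k)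
      + L / fact p * (\<epsilon> + \<delta>)" for \<delta>
  have "(r \<longlongrightarrow> r 0) (at_right 0)"
  proof -
    \<comment> \<open>The positive exponent gives continuity from the right also at base
      \<open>0\<close>, where \<open>0 powr e\<close> is \<open>0\<close>.\<close>
    have powr: "((\<lambda>\<delta>. (a + \<delta>) powr e) \<longlongrightarrow> (a + 0) powr e) (at_right 0)" if "0 \<le> a" "0 < e" for a e :: real
      using that by (intro tendsto_powr' tendsto_intros) (auto simp: eventually_at_right_less intro!: eventually_at_rightI[of 0 1])
    show ?thesis
      unfolding r_def[abs_def]
      by (intro tendsto_add tendsto_sum tendsto_divide tendsto_mult tendsto_const tendsto_ident_at powr A0 \<epsilon>)
        (auto simp: q_def m)
  qed
  then have r_lim: "((\<lambda>\<delta>. ennreal (r \<delta>)) \<longlongrightarrow> ennreal (r 0)) (at_right 0)"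
    by (rule tendsto_ennrealI)
  have expect: "ext_expectation Q loss
      = enn2ereal (\<integral>\<^sup>+z. ennreal (f z) \<partial>Q) - enn2ereal (\<integral>\<^sup>+z. ennreal (- f z) \<partial>Q)"
    if "Q \<in> distributions_on Z" for Q
  proof -
    have "loss z = ereal (f z)" if "z \<in> space Q" for z
      using that S(3) loss by (auto simp: distributions_onD(3)[OF \<open>Q \<in> distributions_on Z\<close>])
    then show ?thesis
      by (simp add: ext_expectation_def cong: nn_integral_cong_simp)
  qed
  have "integrable P f"
    using assms(8) by (simp add: f_def[abs_def])
  then have "(\<integral>\<^sup>+z. ennreal (f z) \<partial>P) < \<infinity>" "(\<integral>\<^sup>+z. ennreal (- f z) \<partial>P) < \<infinity>"
    by (auto simp: real_integrable_def less_top)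
  then obtain a' b' where P_int: "(\<integral>\<^sup>+z. ennreal (f z) \<partial>P) = ennreal a'" "0 \<le> a'"
    "(\<integral>\<^sup>+z. ennreal (- f z) \<partial>P) = ennreal b'" "0 \<le> b'"
    by (metis ennreal_cases infinity_ennreal_def less_irrefl)
  have EP: "ext_expectation P loss = ereal (a' - b')"
    using P_int by (simp add: expect[OF P])
  have main: "ext_expectation Q loss \<le> ereal (a' - b' + r 0)" if "Q \<in> ot_ball Z c \<epsilon> P" for Q
  proof -
    have Q: "Q \<in> distributions_on Z" and cost: "ot_cost c Q P \<le> ennreal \<epsilon>"
      using that by (auto simp: ot_ball_def)
    interpret Q: prob_space Q
      by (rule distributions_onD[OF Q])
    have dist: "(\<integral>\<^sup>+x. ennreal (N (fst x - snd x) ^ p) \<partial>\<pi>) \<le> (\<integral>\<^sup>+(z, w). c z w \<partial>\<pi>)"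
      if "\<pi> \<in> couplings Q P" for \<pi>
      using assms(16) by (intro nn_integral_mono)
        (auto simp: couplingsD(4)[OF that] distributions_onD(3)[OF P] distributions_onD(3)[OF Q])
    have "(\<integral>\<^sup>+z. ennreal (f z) \<partial>Q) + (\<integral>\<^sup>+z. ennreal (- f z) \<partial>P)
        \<le> (\<integral>\<^sup>+z. ennreal (f z) \<partial>P) + (\<integral>\<^sup>+z. ennreal (- f z) \<partial>Q) + ennreal (r \<delta>)" if "0 < \<delta>" for \<delta>
    proof -
      obtain \<pi> where \<pi>: "\<pi> \<in> couplings Q P" "(\<integral>\<^sup>+(z, w). c z w \<partial>\<pi>) \<le> ennreal (\<epsilon> + \<delta>)"
        using ot_cost_le_imp_coupling[OF cost \<open>0 < \<delta>\<close> \<epsilon>] .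
      have A\<delta>: "(\<integral>\<^sup>+z. ennreal (D k z powr (real (Suc m) / real (Suc m - k))) \<partial>P) \<le> ennreal (A k + \<delta>)"
        if "k \<in> {1..m}" for k
        using A(2)[OF that] A0 \<open>0 < \<delta>\<close> unfolding q_def m by (simp add: ennreal_leI del: of_nat_Suc)
      show ?thesis
        unfolding r_def q_def m
      proof (rule coupling_taylor_bound[OF Q P \<pi>(1) N f_meas D_meas D0 _ taylor _ _ _ A\<delta>])
        show "(\<integral>\<^sup>+x. ennreal (N (fst x - snd x) ^ Suc m) \<partial>\<pi>) \<le> ennreal (\<epsilon> + \<delta>)"
          using order_trans[OF dist[OF \<pi>(1)] \<pi>(2)] by (simp only: m)
      qed (use that \<epsilon> A0 L0 in \<open>auto simp: add_nonneg_pos\<close>)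
    qed
    \<comment> \<open>The coupling depends on \<open>\<delta>\<close>, but the inequality obtained
      from it mentions only the marginals, so \<open>\<delta>\<close> can tend to
      \<open>0\<close>.\<close>
    then have le: "(\<integral>\<^sup>+z. ennreal (f z) \<partial>Q) + (\<integral>\<^sup>+z. ennreal (- f z) \<partial>P)
        \<le> (\<integral>\<^sup>+z. ennreal (f z) \<partial>P) + (\<integral>\<^sup>+z. ennreal (- f z) \<partial>Q) + ennreal (r 0)"
      by (intro tendsto_lowerbound[OF tendsto_add[OF tendsto_const r_lim]])
        (auto intro!: eventually_at_rightI[of 0 1])
    \<comment> \<open>An infinite positive part would make \<open>ext_expectation\<close> infinite.
      It is excluded by transporting the \<open>p\<close>-th moment from \<open>P\<close> to
      \<open>Q\<close> along a coupling of finite cost, with slack \<open>1\<close>, and using the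
      growth of the loss.\<close>
    have Q_pos: "(\<integral>\<^sup>+z. ennreal (f z) \<partial>Q) < \<infinity>"
    proof -
      obtain \<pi> where \<pi>: "\<pi> \<in> couplings Q P" "(\<integral>\<^sup>+(z, w). c z w \<partial>\<pi>) \<le> ennreal (\<epsilon> + 1)"
        using ot_cost_le_imp_coupling[OF cost zero_less_one \<epsilon>] .
      note \<pi>D = couplingsD[OF \<pi>(1)]
      have fs: "fst \<in> borel_measurable \<pi>" "snd \<in> borel_measurable \<pi>"
        using measurable_compose[OF \<pi>D(2) borel[OF Q measurable_ident]]
          measurable_compose[OF \<pi>D(3) borel[OF P measurable_ident]] by simp_all
      have "(\<integral>\<^sup>+x. ennreal (N (fst x - snd x) ^ p) \<partial>\<pi>) < \<infinity>"
        using le_less_trans[OF order_trans[OF dist[OF \<pi>(1)] \<pi>(2)]] by simp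
      moreover have "(\<integral>\<^sup>+x. ennreal (N (snd x) ^ p) \<partial>\<pi>) < \<infinity>"
        using P_moment by (subst \<pi>D(6)[of "\<lambda>z. ennreal (N z ^ p)"]) (auto intro!: borel[OF P])
      ultimately have "(\<integral>\<^sup>+x. ennreal (N ((fst x - snd x) + snd x) ^ p) \<partial>\<pi>) < \<infinity>"
        using fs by (intro nn_integral_norm_power_add N) auto
      then have Q_moment: "(\<integral>\<^sup>+z. ennreal (N z ^ p) \<partial>Q) < \<infinity>"
        by (simp add: \<pi>D(5)[of "\<lambda>z. ennreal (N z ^ p)"] borel[OF Q])
      show ?thesis
      proof (rule nn_integral_growth_finite[OF Q.prob_space_axioms _ _ Q_moment])
        show "f z \<le> G * (1 + N z ^ p)" if "z \<in> space Q" for z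
          using that S(3) by (intro fG) (auto simp: distributions_onD(3)[OF Q])
      qed (use G is_normD(1)[OF N] in \<open>auto intro!: borel[OF Q]\<close>)
    qed
    have r0: "0 \<le> r 0"
      unfolding r_def using A0 L0 \<epsilon> by (intro add_nonneg_nonneg sum_nonneg) auto
    show ?thesis
    \<comment> \<open>If the negative part has infinite integral, the expectation is minus infinity
      and the bound is trivial; otherwise \<open>le\<close> is an inequality between real
      numbers.\<close>
    proof (cases "(\<integral>\<^sup>+z. ennreal (f z) \<partial>Q)"; cases "(\<integral>\<^sup>+z. ennreal (- f z) \<partial>Q)")
      fix x y assume "(\<integral>\<^sup>+z. ennreal (f z) \<partial>Q) = ennreal x" "0 \<le> x"
        "(\<integral>\<^sup>+z. ennreal (- f z) \<partial>Q) = ennreal y" "0 \<le> y"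
      then show ?thesis
        using le P_int r0 by (simp add: expect[OF Q] flip: ennreal_plus)
    qed (use Q_pos in \<open>auto simp: expect[OF Q]\<close>)
  qed
  \<comment> \<open>All moments are finite, so the extended sum in the claim is the image of the
    real sum in \<open>r 0\<close>. The whole bound is then a real number, which also gives its
    finiteness.\<close>
  have "(\<Sum>k=1..m. ennreal (\<epsilon> powr (1 / (real p / real k)) / fact k) *
          enn_powr (\<integral>\<^sup>+z. enn_powr (deriv_norm N loss k z) (q k) \<partial>P) (1 / q k))
      = (\<Sum>k=1..m. ennreal (A k powr (1 / q k) * \<epsilon> powr (1 / (real p / real k)) / fact k))"
  proof (rule sum.cong[OF refl])
    fix k assume "k \<in> {1..m}"
    then have "enn_powr (\<integral>\<^sup>+z. enn_powr (deriv_norm N loss k z) (q k) \<partial>P) (1 / q k)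
        = ennreal (A k powr (1 / q k))"
      using A0 by (subst A(1)) (auto simp: enn_powr_def)
    then show "ennreal (\<epsilon> powr (1 / (real p / real k)) / fact k) *
          enn_powr (\<integral>\<^sup>+z. enn_powr (deriv_norm N loss k z) (q k) \<partial>P) (1 / q k)
        = ennreal (A k powr (1 / q k) * \<epsilon> powr (1 / (real p / real k)) / fact k)"
      by (simp add: mult.commute flip: ennreal_mult)
  qed
  also have "\<dots> = ennreal (\<Sum>k=1..m. A k powr (1 / q k) * \<epsilon> powr (1 / (real p / real k)) / fact k)"
    by (rule sum_ennreal) simp
  finally have sum: "enn2ereal (\<Sum>k=1..m. ennreal (\<epsilon> powr (1 / (real p / real k)) / fact k) *
          enn_powr (\<integral>\<^sup>+z. enn_powr (deriv_norm N loss k z) (q k) \<partial>P) (1 / q k))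
      = ereal (\<Sum>k=1..m. A k powr (1 / q k) * \<epsilon> powr (1 / (real p / real k)) / fact k)"
    by (simp add: sum_nonneg)
  have rem: "enn2ereal (ennreal (\<epsilon> / fact p) * deriv_lip N loss m) = ereal (L / fact p * \<epsilon>)"
    using \<epsilon> L0 by (simp add: lip mult.commute flip: ennreal_mult)
  have bound: "ext_expectation P loss
       + enn2ereal (\<Sum>k=1..m. ennreal (\<epsilon> powr (1 / (real p / real k)) / fact k) *
                   enn_powr (\<integral>\<^sup>+z. enn_powr (deriv_norm N loss k z) (q k) \<partial>P) (1 / q k))
       + enn2ereal (ennreal (\<epsilon> / fact p) * deriv_lip N loss m) = ereal (a' - b' + r 0)"
    unfolding EP sum rem by (simp add: r_def)
  have "p - 1 = m"
    by (simp add: m)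
  then show ?thesis
    unfolding Let_def using bound main by (simp add: q_def SUP_le_iff)
qed

end
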